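(* Let $F$ be a field of characteristic zero and let $q\in F\setminus\{0\}$. The elements $x$ and $y$ of the quantum plane $\mathcal{O}_q(F^2)$ are prime. Moreover: (1) If $q$ is not a root of unity, then every prime polynomial in $\mathcal{O}_q(F^2)$ is a scalar multiple of $x$ or a scalar multiple of $y$. (2) If $q$ is a primitive $n$-th root of unity for some positive integer $n$, then every prime polynomial in $\mathcal{O}_q(F^2)$ is either central and irreducible, or a scalar multiple of $x$ or of $y$.
   Context: The quantum plane $\mathcal{O}_q(F^2)$ is the $F$-algebra generated by two variables $x,y$ subject to the single relation $yx=qxy$; the elements $x^iy^j$ ($i,j\in\mathbb{N}=\{0,1,2,\dots\}$) form an $F$-basis, and the elements of $\mathcal{O}_q(F^2)$ are called polynomials. Constants (scalars) are the elements of $F$. A nonzero polynomial is reducible if it equals $gh$ for some nonconstant $g,h\in\mathcal{O}_q(F^2)$; it is irreducible if it is nonconstant and not reducible. In a ring $R$, an element $r$ divides $s$ (written $r\mid s$) if there exists $t\in R$ with $s=rt$ or $s=tr$. An element $r\in R$ is prime if it is nonzero, not a unit, and for all $s,t\in R$, $r\mid st$ implies $r\mid s$ or $r\mid t$. An element $r$ is central if $rs=sr$ for all $s\in R$. *)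

theory Defs
  imports "HOL-Algebra.Ring" "HOL-Library.Poly_Mapping"
begin

text \<open>
  An element of the quantum plane is represented by its coefficient function with respect to
  the basis \<open>x^i y^j\<close>: the coefficient of \<open>x^i y^j\<close> is the value at \<open>(i, j)\<close>.
  The product is the bilinear extension of
  \<open>(x^i y^j) (x^k y^l) = q^(j k) x^(i+k) y^(j+l)\<close>, which is what the relation \<open>y x = q x y\<close> forces.
  The lemmas below confirm that this is an associative \<open>F\<close>-algebra generated by \<open>x\<close> and \<open>y\<close>,
  that the relation holds, and that the elements \<open>x^i y^j\<close> form a basis.
\<close>

definition qp_mult ::
  "'a::field \<Rightarrow> (nat \<times> nat \<Rightarrow>\<^sub>0 'a) \<Rightarrow> (nat \<times> nat \<Rightarrow>\<^sub>0 'a) \<Rightarrow> (nat \<times> nat \<Rightarrow>\<^sub>0 'a)" where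
  "qp_mult q f g =
     (\<Sum>m\<in>Poly_Mapping.keys f. \<Sum>k\<in>Poly_Mapping.keys g.
        Poly_Mapping.single (fst m + fst k, snd m + snd k)
          (q ^ (snd m * fst k) * Poly_Mapping.lookup f m * Poly_Mapping.lookup g k))"

definition qp_const :: "'a::field \<Rightarrow> (nat \<times> nat \<Rightarrow>\<^sub>0 'a)" where
  "qp_const c = Poly_Mapping.single (0, 0) c"

definition qp_x :: "nat \<times> nat \<Rightarrow>\<^sub>0 'a::field" where
  "qp_x = Poly_Mapping.single (1, 0) 1"

definition qp_y :: "nat \<times> nat \<Rightarrow>\<^sub>0 'a::field" where
  "qp_y = Poly_Mapping.single (0, 1) 1"

definition quantum_plane :: "'a::field \<Rightarrow> (nat \<times> nat \<Rightarrow>\<^sub>0 'a) ring" where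
  "quantum_plane q =
     \<lparr>carrier = UNIV, mult = qp_mult q, one = qp_const 1, zero = 0, add = (+)\<rparr>"

definition qp_constants :: "(nat \<times> nat \<Rightarrow>\<^sub>0 'a::field) set" where
  "qp_constants = range qp_const"

definition qp_reducible :: "'a::field \<Rightarrow> (nat \<times> nat \<Rightarrow>\<^sub>0 'a) \<Rightarrow> bool" where
  "qp_reducible q f \<longleftrightarrow>
     f \<noteq> 0 \<and> (\<exists>g h. g \<notin> qp_constants \<and> h \<notin> qp_constants \<and> f = g \<otimes>\<^bsub>quantum_plane q\<^esub> h)"

definition qp_irreducible :: "'a::field \<Rightarrow> (nat \<times> nat \<Rightarrow>\<^sub>0 'a) \<Rightarrow> bool" where
  "qp_irreducible q f \<longleftrightarrow> f \<notin> qp_constants \<and> \<not> qp_reducible q f"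

definition scalar_multiple_of ::
  "'a::field \<Rightarrow> (nat \<times> nat \<Rightarrow>\<^sub>0 'a) \<Rightarrow> (nat \<times> nat \<Rightarrow>\<^sub>0 'a) \<Rightarrow> bool" where
  "scalar_multiple_of q f g \<longleftrightarrow> (\<exists>c. f = qp_const c \<otimes>\<^bsub>quantum_plane q\<^esub> g)"

text \<open>
  The library's divisibility in a monoid only allows the cofactor on the right, and its primes are
  built on that. The notions below, meant for noncommutative rings, allow it on either side.
\<close>

definition nc_divides :: "('r, 'm) ring_scheme \<Rightarrow> 'r \<Rightarrow> 'r \<Rightarrow> bool" where
  "nc_divides R r s \<longleftrightarrow> (\<exists>t\<in>carrier R. s = r \<otimes>\<^bsub>R\<^esub> t \<or> s = t \<otimes>\<^bsub>R\<^esub> r)"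

definition nc_prime :: "('r, 'm) ring_scheme \<Rightarrow> 'r \<Rightarrow> bool" where
  "nc_prime R r \<longleftrightarrow>
     r \<in> carrier R \<and> r \<noteq> \<zero>\<^bsub>R\<^esub> \<and> r \<notin> Units R \<and>
     (\<forall>s\<in>carrier R. \<forall>t\<in>carrier R.
        nc_divides R r (s \<otimes>\<^bsub>R\<^esub> t) \<longrightarrow> nc_divides R r s \<or> nc_divides R r t)"

definition central_in :: "('r, 'm) ring_scheme \<Rightarrow> 'r \<Rightarrow> bool" where
  "central_in R r \<longleftrightarrow> r \<in> carrier R \<and> (\<forall>s\<in>carrier R. r \<otimes>\<^bsub>R\<^esub> s = s \<otimes>\<^bsub>R\<^esub> r)"

definition root_of_unity :: "'a::field \<Rightarrow> bool" where
  "root_of_unity q \<longleftrightarrow> (\<exists>n>0. q ^ n = 1)"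

definition primitive_root_of_unity :: "nat \<Rightarrow> 'a::field \<Rightarrow> bool" where
  "primitive_root_of_unity n q \<longleftrightarrow> n > 0 \<and> q ^ n = 1 \<and> (\<forall>k. 0 < k \<and> k < n \<longrightarrow> q ^ k \<noteq> 1)"

lemma poly_mapping_sum_singles:
  fixes f :: "'k \<Rightarrow>\<^sub>0 'a::comm_monoid_add"
  shows "f = (\<Sum>k\<in>Poly_Mapping.keys f. Poly_Mapping.single k (Poly_Mapping.lookup f k))"
  by (rule poly_mapping_eqI)
     (auto simp: lookup_sum lookup_single when_def in_keys_iff)

lemma poly_mapping_additive_induct:
  fixes f :: "'k \<Rightarrow>\<^sub>0 'a::comm_monoid_add"
  assumes "P 0" "\<And>k c. P (Poly_Mapping.single k c)" "\<And>f g. P f \<Longrightarrow> P g \<Longrightarrow> P (f + g)"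
  shows "P f"
proof -
  have "P (\<Sum>k\<in>A. Poly_Mapping.single k (Poly_Mapping.lookup f k))" if "finite A" for A
    using that by (induction A) (use assms in auto)
  from this[of "Poly_Mapping.keys f"] show ?thesis
    using poly_mapping_sum_singles[of f] by simp
qed

lemma qp_mult_superset:
  assumes "finite A" "finite B" "Poly_Mapping.keys f \<subseteq> A" "Poly_Mapping.keys g \<subseteq> B"
  shows "qp_mult q f g =
     (\<Sum>m\<in>A. \<Sum>k\<in>B.
        Poly_Mapping.single (fst m + fst k, snd m + snd k)
          (q ^ (snd m * fst k) * Poly_Mapping.lookup f m * Poly_Mapping.lookup g k))"
proof -
  have "qp_mult q f g =
     (\<Sum>m\<in>Poly_Mapping.keys f. \<Sum>k\<in>B.
        Poly_Mapping.single (fst m + fst k, snd m + snd k)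
          (q ^ (snd m * fst k) * Poly_Mapping.lookup f m * Poly_Mapping.lookup g k))"
    unfolding qp_mult_def
    by (intro sum.cong refl sum.mono_neutral_left) (use assms in \<open>auto simp: in_keys_iff\<close>)
  also have "\<dots> = (\<Sum>m\<in>A. \<Sum>k\<in>B.
        Poly_Mapping.single (fst m + fst k, snd m + snd k)
          (q ^ (snd m * fst k) * Poly_Mapping.lookup f m * Poly_Mapping.lookup g k))"
    by (intro sum.mono_neutral_left) (use assms in \<open>auto simp: in_keys_iff\<close>)
  finally show ?thesis .
qed

lemma qp_mult_add_left: "qp_mult q (f + g) h = qp_mult q f h + qp_mult q g h"
proof -
  let ?A = "Poly_Mapping.keys f \<union> Poly_Mapping.keys g" and ?B = "Poly_Mapping.keys h"
  have "Poly_Mapping.keys (f + g) \<subseteq> ?A" by (rule keys_add)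
  then show ?thesis
    by (simp add: qp_mult_superset[of ?A ?B] lookup_add algebra_simps single_add sum.distrib)
qed

lemma qp_mult_add_right: "qp_mult q h (f + g) = qp_mult q h f + qp_mult q h g"
proof -
  let ?A = "Poly_Mapping.keys f \<union> Poly_Mapping.keys g" and ?B = "Poly_Mapping.keys h"
  have "Poly_Mapping.keys (f + g) \<subseteq> ?A" by (rule keys_add)
  then show ?thesis
    by (simp add: qp_mult_superset[of ?B ?A] lookup_add algebra_simps single_add sum.distrib)
qed

lemma qp_mult_zero [simp]: "qp_mult q 0 f = 0" "qp_mult q f 0 = 0"
  by (simp_all add: qp_mult_def)

lemma qp_mult_single:
  "qp_mult q (Poly_Mapping.single (i, j) a) (Poly_Mapping.single (k, l) b) =
     Poly_Mapping.single (i + k, j + l) (q ^ (j * k) * a * b)"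
  by (simp add: qp_mult_superset[of "{(i, j)}" "{(k, l)}"])

lemma qp_mult_assoc: "qp_mult q (qp_mult q f g) h = qp_mult q f (qp_mult q g h)"
proof (induction f rule: poly_mapping_additive_induct)
  case (2 m a)
  show ?case
  proof (induction g rule: poly_mapping_additive_induct)
    case (2 n b)
    show ?case
    proof (induction h rule: poly_mapping_additive_induct)
      case (2 p c)
      show ?case
        by (cases m; cases n; cases p) (simp add: qp_mult_single algebra_simps power_add)
    qed (simp_all add: qp_mult_add_right)
  qed (simp_all add: qp_mult_add_right qp_mult_add_left)
qed (simp_all add: qp_mult_add_left)

lemma qp_const_mult: "qp_mult q (qp_const c) f = qp_mult q f (qp_const c)"
  unfolding qp_const_def
proof (induction f rule: poly_mapping_additive_induct)
  case (2 k d)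
  then show ?case by (cases k) (simp add: qp_mult_single mult.commute)
qed (simp_all add: qp_mult_add_left qp_mult_add_right)

lemma qp_one_mult: "qp_mult q (qp_const 1) f = f"
  unfolding qp_const_def
proof (induction f rule: poly_mapping_additive_induct)
  case (2 k c)
  then show ?case by (cases k) (simp add: qp_mult_single)
qed (simp_all add: qp_mult_add_right)

lemma quantum_plane_simps [simp]:
  "carrier (quantum_plane q) = UNIV"
  "f \<otimes>\<^bsub>quantum_plane q\<^esub> g = qp_mult q f g"
  "\<one>\<^bsub>quantum_plane q\<^esub> = qp_const 1"
  "\<zero>\<^bsub>quantum_plane q\<^esub> = 0"
  "f \<oplus>\<^bsub>quantum_plane q\<^esub> g = f + g"
  by (simp_all add: quantum_plane_def)

lemma ring_quantum_plane: "ring (quantum_plane q)"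
proof (rule ringI)
  show "abelian_group (quantum_plane q)"
  proof (rule abelian_groupI)
    fix f assume "f \<in> carrier (quantum_plane q)"
    show "\<exists>g\<in>carrier (quantum_plane q). g \<oplus>\<^bsub>quantum_plane q\<^esub> f = \<zero>\<^bsub>quantum_plane q\<^esub>"
      by (rule bexI[of _ "- f"]) simp_all
  qed (simp_all add: algebra_simps)
  show "monoid (quantum_plane q)"
    by (rule monoidI) (simp_all add: qp_mult_assoc qp_one_mult qp_const_mult[symmetric])
qed (simp_all add: qp_mult_add_left qp_mult_add_right)

lemma central_in_qp_const: "central_in (quantum_plane q) (qp_const c)"
  by (simp add: central_in_def qp_const_mult)

lemma qp_const_ring_hom:
  "qp_const (a + b) = qp_const a \<oplus>\<^bsub>quantum_plane q\<^esub> qp_const b"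
  "qp_const (a * b) = qp_const a \<otimes>\<^bsub>quantum_plane q\<^esub> qp_const b"
  by (simp_all add: qp_const_def single_add qp_mult_single)

lemma qp_relation:
  "qp_y \<otimes>\<^bsub>quantum_plane q\<^esub> qp_x =
     qp_const q \<otimes>\<^bsub>quantum_plane q\<^esub> (qp_x \<otimes>\<^bsub>quantum_plane q\<^esub> qp_y)"
  by (simp add: qp_x_def qp_y_def qp_const_def qp_mult_single)

lemma qp_monomial:
  "qp_const c \<otimes>\<^bsub>quantum_plane q\<^esub>
     (qp_x [^]\<^bsub>quantum_plane q\<^esub> i \<otimes>\<^bsub>quantum_plane q\<^esub> qp_y [^]\<^bsub>quantum_plane q\<^esub> j) =
   Poly_Mapping.single (i, j) c"
  for i j :: nat
proof -
  interpret ring "quantum_plane q" by (rule ring_quantum_plane)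
  have "qp_x [^]\<^bsub>quantum_plane q\<^esub> i = Poly_Mapping.single (i, 0) 1"
    by (induction i) (simp_all add: qp_const_def qp_x_def qp_mult_single)
  moreover have "qp_y [^]\<^bsub>quantum_plane q\<^esub> j = Poly_Mapping.single (0, j) 1"
    by (induction j) (simp_all add: qp_const_def qp_y_def qp_mult_single)
  ultimately show ?thesis by (simp add: qp_const_def qp_mult_single)
qed

lemma qp_basis_expansion:
  "f = (\<Sum>(i, j)\<in>Poly_Mapping.keys f.
     qp_const (Poly_Mapping.lookup f (i, j)) \<otimes>\<^bsub>quantum_plane q\<^esub>
       (qp_x [^]\<^bsub>quantum_plane q\<^esub> i \<otimes>\<^bsub>quantum_plane q\<^esub> qp_y [^]\<^bsub>quantum_plane q\<^esub> j))"
  unfolding qp_monomial using poly_mapping_sum_singles[of f] by (simp add: case_prod_unfold)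

lemma qp_basis_independent:
  fixes c :: "nat \<Rightarrow> nat \<Rightarrow> 'a::field"
  assumes "finite A" and "(i, j) \<in> A"
    and "(\<Sum>(k, l)\<in>A. qp_const (c k l) \<otimes>\<^bsub>quantum_plane q\<^esub>
       (qp_x [^]\<^bsub>quantum_plane q\<^esub> k \<otimes>\<^bsub>quantum_plane q\<^esub> qp_y [^]\<^bsub>quantum_plane q\<^esub> l)) = 0"
  shows "c i j = 0"
proof -
  have "0 = Poly_Mapping.lookup (\<Sum>(k, l)\<in>A. Poly_Mapping.single (k, l) (c k l)) (i, j)"
    using assms(3) unfolding qp_monomial by (simp only: lookup_zero)
  also have "\<dots> = (\<Sum>m\<in>A. c (fst m) (snd m) when m = (i, j))"
    by (simp add: lookup_sum case_prod_unfold lookup_single)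
  also have "\<dots> = c i j"
    using assms(1,2) by (simp add: when_def)
  finally show ?thesis by simp
qed

end

theory Submission
  imports Defs "HOL-Library.Product_Lexorder"
begin

text \<open>
  For integer weights \<open>\<alpha>, \<beta>\<close>, let the weighted order of a nonzero polynomial be the least value of
  \<open>\<alpha> i + \<beta> j\<close> over the monomials \<open>x^i y^j\<close> that occur in it. Since \<open>q \<noteq> 0\<close>, this order is additive
  on products (\<open>worder_mult\<close>): the powers of \<open>q\<close> do not make extremal terms vanish. The weights \<open>(1, 0)\<close> and
  \<open>(0, 1)\<close> measure divisibility by \<open>x\<close> and by \<open>y\<close>, so additivity says that \<open>x\<close> and \<open>y\<close> are prime.
  The weights \<open>(-1, -1)\<close> give the negative of the total degree, which shows that the quantum plane
  is a domain whose primes are irreducible.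

  Let \<open>p\<close> be any prime. Moving \<open>x\<close> past \<open>p\<close> gives \<open>p x = x p'\<close>, where \<open>p'\<close> arises from \<open>p\<close> by
  scaling the coefficient of \<open>x^i y^j\<close> by \<open>q^j\<close>. As \<open>p\<close> divides the left-hand side, it divides \<open>x\<close>
  or \<open>p'\<close>. In the first case it is a scalar multiple of \<open>x\<close>. In the second, equality of degrees
  forces \<open>p' = c p\<close>, so \<open>q^j = c\<close> for every monomial of \<open>p\<close>. If \<open>c \<noteq> 1\<close>, then \<open>j = 0\<close> never occurs,
  so \<open>y\<close> divides \<open>p\<close>, and \<open>p\<close> is a scalar multiple of \<open>y\<close> because it is irreducible. Otherwise
  \<open>q^j = 1\<close> throughout. The same argument with \<open>y\<close> gives \<open>q^i = 1\<close> throughout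
  (\<open>nc_prime_trichotomy\<close>). Such a \<open>p\<close> commutes with all monomials, hence is central; and if \<open>q\<close> is
  not a root of unity, only \<open>i = j = 0\<close> is possible, which would make \<open>p\<close> constant.
\<close>

section \<open>The weighted order of a polynomial\<close>

definition weight :: "int \<Rightarrow> int \<Rightarrow> nat \<times> nat \<Rightarrow> int" where
  "weight \<alpha> \<beta> k = \<alpha> * int (fst k) + \<beta> * int (snd k)"

definition worder :: "int \<Rightarrow> int \<Rightarrow> (nat \<times> nat \<Rightarrow>\<^sub>0 'a::zero) \<Rightarrow> int" where
  "worder \<alpha> \<beta> f = Min (weight \<alpha> \<beta> ` Poly_Mapping.keys f)"

lemma weight_add: "weight \<alpha> \<beta> (fst a + fst b, snd a + snd b) = weight \<alpha> \<beta> a + weight \<alpha> \<beta> b"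
  by (simp add: weight_def algebra_simps)

lemma single_eq_0_iff: "Poly_Mapping.single k c = 0 \<longleftrightarrow> c = 0"
  by (metis lookup_single_eq lookup_zero single_zero)

lemma worder_le: "k \<in> Poly_Mapping.keys f \<Longrightarrow> worder \<alpha> \<beta> f \<le> weight \<alpha> \<beta> k"
  by (simp add: worder_def)

lemma worder_eqI:
  assumes "k \<in> Poly_Mapping.keys f" "\<And>l. l \<in> Poly_Mapping.keys f \<Longrightarrow> weight \<alpha> \<beta> k \<le> weight \<alpha> \<beta> l"
  shows "worder \<alpha> \<beta> f = weight \<alpha> \<beta> k"
  unfolding worder_def by (rule Min_eqI) (use assms in auto)

lemma worder_attained:
  assumes "f \<noteq> 0"
  obtains k where "k \<in> Poly_Mapping.keys f" "worder \<alpha> \<beta> f = weight \<alpha> \<beta> k"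
proof -
  have "worder \<alpha> \<beta> f \<in> weight \<alpha> \<beta> ` Poly_Mapping.keys f"
    unfolding worder_def by (rule Min_in) (use assms in auto)
  then show thesis using that by auto
qed

lemma worder_cong: "Poly_Mapping.keys f = Poly_Mapping.keys g \<Longrightarrow> worder \<alpha> \<beta> f = worder \<alpha> \<beta> g"
  by (simp add: worder_def)

lemma worder_single: "c \<noteq> 0 \<Longrightarrow> worder \<alpha> \<beta> (Poly_Mapping.single k c) = weight \<alpha> \<beta> k"
  by (simp add: worder_def)

lemma keys_qp_mult:
  assumes "k \<in> Poly_Mapping.keys (qp_mult q f g)"
  obtains a b where "a \<in> Poly_Mapping.keys f" "b \<in> Poly_Mapping.keys g"
    "k = (fst a + fst b, snd a + snd b)"
proof -
  have "\<exists>a\<in>Poly_Mapping.keys f. \<exists>b\<in>Poly_Mapping.keys g. (fst a + fst b, snd a + snd b) = k"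
  proof (rule ccontr)
    assume "\<not> ?thesis"
    then have "Poly_Mapping.lookup (qp_mult q f g) k = 0"
      unfolding qp_mult_def lookup_sum lookup_single when_def
      by (intro sum.neutral ballI) auto
    then show False using assms by (simp add: in_keys_iff)
  qed
  then show thesis using that by blast
qed

lemma lookup_qp_mult_unique:
  assumes "a \<in> Poly_Mapping.keys f" "b \<in> Poly_Mapping.keys g"
    and unique: "\<And>a' b'. a' \<in> Poly_Mapping.keys f \<Longrightarrow> b' \<in> Poly_Mapping.keys g \<Longrightarrow>
      fst a' + fst b' = fst a + fst b \<Longrightarrow> snd a' + snd b' = snd a + snd b \<Longrightarrow> a' = a \<and> b' = b"
  shows "Poly_Mapping.lookup (qp_mult q f g) (fst a + fst b, snd a + snd b) =
    q ^ (snd a * fst b) * Poly_Mapping.lookup f a * Poly_Mapping.lookup g b"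
proof -
  let ?c = "\<lambda>m k. q ^ (snd m * fst k) * Poly_Mapping.lookup f m * Poly_Mapping.lookup g k"
  have "Poly_Mapping.lookup (qp_mult q f g) (fst a + fst b, snd a + snd b) =
      (\<Sum>m\<in>Poly_Mapping.keys f. \<Sum>k\<in>Poly_Mapping.keys g. if k = b then if m = a then ?c m k else 0 else 0)"
    unfolding qp_mult_def lookup_sum lookup_single when_def
    by (intro sum.cong refl) (use unique in auto)
  also have "\<dots> = ?c a b"
    using assms(1,2) by simp
  finally show ?thesis .
qed

text \<open>
  Several terms of each factor may have least weight. Breaking ties lexicographically selects one
  term in each factor, and the product of these two is the only contribution to its monomial, so
  it cannot cancel.
\<close>

lemma extremal_key_qp_mult:
  assumes "q \<noteq> 0" "f \<noteq> 0" "g \<noteq> 0"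
  obtains a b where "a \<in> Poly_Mapping.keys f" "b \<in> Poly_Mapping.keys g"
    "worder \<alpha> \<beta> f = weight \<alpha> \<beta> a" "worder \<alpha> \<beta> g = weight \<alpha> \<beta> b"
    "(fst a + fst b, snd a + snd b) \<in> Poly_Mapping.keys (qp_mult q f g)"
proof -
  let ?T = "\<lambda>k. (weight \<alpha> \<beta> k, k)"
  have min: "\<exists>a\<in>Poly_Mapping.keys h. \<forall>a'\<in>Poly_Mapping.keys h. ?T a \<le> ?T a'"
    if "h \<noteq> 0" for h :: "nat \<times> nat \<Rightarrow>\<^sub>0 'a"
  proof -
    let ?M = "Min (?T ` Poly_Mapping.keys h)"
    have "?M \<in> ?T ` Poly_Mapping.keys h"
      by (rule Min_in) (use that in auto)
    then obtain a where a: "?M = ?T a" "a \<in> Poly_Mapping.keys h"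
      by (rule imageE)
    have "?T a \<le> ?T a'" if "a' \<in> Poly_Mapping.keys h" for a'
      unfolding a(1)[symmetric] by (rule Min_le) (use that in auto)
    then show ?thesis using a(2) by blast
  qed
  obtain a where a: "a \<in> Poly_Mapping.keys f" "\<And>a'. a' \<in> Poly_Mapping.keys f \<Longrightarrow> ?T a \<le> ?T a'"
    using min[OF assms(2)] by blast
  obtain b where b: "b \<in> Poly_Mapping.keys g" "\<And>b'. b' \<in> Poly_Mapping.keys g \<Longrightarrow> ?T b \<le> ?T b'"
    using min[OF assms(3)] by blast
  have "Poly_Mapping.lookup (qp_mult q f g) (fst a + fst b, snd a + snd b) =
      q ^ (snd a * fst b) * Poly_Mapping.lookup f a * Poly_Mapping.lookup g b"
  proof (rule lookup_qp_mult_unique[OF a(1) b(1)])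
    fix a' b'
    assume *: "a' \<in> Poly_Mapping.keys f" "b' \<in> Poly_Mapping.keys g"
      "fst a' + fst b' = fst a + fst b" "snd a' + snd b' = snd a + snd b"
    then have "weight \<alpha> \<beta> a' + weight \<alpha> \<beta> b' = weight \<alpha> \<beta> a + weight \<alpha> \<beta> b"
      by (metis weight_add)
    then show "a' = a \<and> b' = b"
      using a(2)[OF *(1)] b(2)[OF *(2)] *(3,4)
      by (auto simp: less_eq_prod_def less_prod_def prod_eq_iff)
  qed
  also have "\<dots> \<noteq> 0"
    using a(1) b(1) assms(1) by (simp add: in_keys_iff)
  finally have "(fst a + fst b, snd a + snd b) \<in> Poly_Mapping.keys (qp_mult q f g)"
    by (simp add: in_keys_iff)
  moreover have "worder \<alpha> \<beta> f = weight \<alpha> \<beta> a"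
    by (rule worder_eqI[OF a(1)]) (drule a(2), auto simp: less_eq_prod_def)
  moreover have "worder \<alpha> \<beta> g = weight \<alpha> \<beta> b"
    by (rule worder_eqI[OF b(1)]) (drule b(2), auto simp: less_eq_prod_def)
  ultimately show thesis
    using that a(1) b(1) by blast
qed

lemma qp_mult_eq_0_iff:
  assumes "q \<noteq> 0"
  shows "qp_mult q f g = 0 \<longleftrightarrow> f = 0 \<or> g = 0"
proof
  assume "qp_mult q f g = 0"
  then have "Poly_Mapping.keys (qp_mult q f g) = {}" by simp
  then show "f = 0 \<or> g = 0"
    using extremal_key_qp_mult[OF assms, of f g] by blast
qed auto

lemma worder_mult:
  assumes "q \<noteq> 0" "f \<noteq> 0" "g \<noteq> 0"
  shows "worder \<alpha> \<beta> (qp_mult q f g) = worder \<alpha> \<beta> f + worder \<alpha> \<beta> g"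
proof -
  obtain a b where ab: "worder \<alpha> \<beta> f = weight \<alpha> \<beta> a" "worder \<alpha> \<beta> g = weight \<alpha> \<beta> b"
    "(fst a + fst b, snd a + snd b) \<in> Poly_Mapping.keys (qp_mult q f g)"
    using extremal_key_qp_mult[OF assms] by metis
  have "worder \<alpha> \<beta> (qp_mult q f g) = weight \<alpha> \<beta> (fst a + fst b, snd a + snd b)"
  proof (rule worder_eqI[OF ab(3)])
    fix l assume "l \<in> Poly_Mapping.keys (qp_mult q f g)"
    then obtain a' b' where *: "a' \<in> Poly_Mapping.keys f" "b' \<in> Poly_Mapping.keys g"
      "l = (fst a' + fst b', snd a' + snd b')"
      by (rule keys_qp_mult)
    show "weight \<alpha> \<beta> (fst a + fst b, snd a + snd b) \<le> weight \<alpha> \<beta> l"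
      using worder_le[OF *(1), of \<alpha> \<beta>] worder_le[OF *(2), of \<alpha> \<beta>] ab(1,2)
      unfolding *(3) weight_add by linarith
  qed
  then show ?thesis
    by (simp add: weight_add ab)
qed

lemma worder_nonneg:
  assumes "f \<noteq> 0" "0 \<le> \<alpha>" "0 \<le> \<beta>"
  shows "0 \<le> worder \<alpha> \<beta> f"
  by (rule worder_attained[OF assms(1), of \<alpha> \<beta>]) (use assms in \<open>simp add: weight_def\<close>)

section \<open>The generators are prime\<close>

lemma qp_mult_sum_right: "qp_mult q f (\<Sum>k\<in>A. g k) = (\<Sum>k\<in>A. qp_mult q f (g k))"
  by (induction A rule: infinite_finite_induct) (simp_all add: qp_mult_add_right)

lemma qp_mult_sum_left: "qp_mult q (\<Sum>k\<in>A. g k) f = (\<Sum>k\<in>A. qp_mult q (g k) f)"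
  by (induction A rule: infinite_finite_induct) (simp_all add: qp_mult_add_left)

lemma qp_x_factor:
  assumes "\<And>k. k \<in> Poly_Mapping.keys f \<Longrightarrow> fst k > 0"
  obtains t where "f = qp_mult q qp_x t"
proof
  show "f = qp_mult q qp_x (\<Sum>k\<in>Poly_Mapping.keys f.
      Poly_Mapping.single (fst k - 1, snd k) (Poly_Mapping.lookup f k))"
    unfolding qp_mult_sum_right
    by (subst poly_mapping_sum_singles[of f], intro sum.cong refl)
      (use assms in \<open>simp add: qp_x_def qp_mult_single\<close>)
qed

lemma qp_y_factor:
  assumes "\<And>k. k \<in> Poly_Mapping.keys f \<Longrightarrow> snd k > 0"
  obtains t where "f = qp_mult q t qp_y"
proof
  show "f = qp_mult q (\<Sum>k\<in>Poly_Mapping.keys f.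
      Poly_Mapping.single (fst k, snd k - 1) (Poly_Mapping.lookup f k)) qp_y"
    unfolding qp_mult_sum_left
    by (subst poly_mapping_sum_singles[of f], intro sum.cong refl)
      (use assms in \<open>simp add: qp_y_def qp_mult_single\<close>)
qed

lemma nc_divides_qp_iff:
  "nc_divides (quantum_plane q) r s \<longleftrightarrow> (\<exists>t. s = qp_mult q r t \<or> s = qp_mult q t r)"
  by (simp add: nc_divides_def)

text \<open>
  The common core for both generators: a polynomial of order 1 is prime as soon as it
  divides everything of positive order, because the order of a product can only be positive if that
  of a factor is.
\<close>

lemma nc_prime_if_worder:
  assumes q: "q \<noteq> 0" and wt: "0 \<le> \<alpha>" "0 \<le> \<beta>"
    and r: "r \<noteq> 0" "worder \<alpha> \<beta> r = 1"
    and dvd: "\<And>f. f \<noteq> 0 \<Longrightarrow> worder \<alpha> \<beta> f > 0 \<Longrightarrow> nc_divides (quantum_plane q) r f"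
  shows "nc_prime (quantum_plane q) r"
proof -
  have pos: "worder \<alpha> \<beta> f > 0" if "nc_divides (quantum_plane q) r f" "f \<noteq> 0" for f
  proof -
    obtain t where t: "f = qp_mult q r t \<or> f = qp_mult q t r"
      using \<open>nc_divides (quantum_plane q) r f\<close> unfolding nc_divides_qp_iff by blast
    then have "t \<noteq> 0" using that(2) by auto
    then show ?thesis
      using t r worder_mult[OF q] worder_nonneg[OF \<open>t \<noteq> 0\<close> wt] by fastforce
  qed
  have dvd0: "nc_divides (quantum_plane q) r 0"
    by (auto simp: nc_divides_qp_iff intro: exI[of _ 0])
  have "r \<notin> Units (quantum_plane q)"
  proof
    assume "r \<in> Units (quantum_plane q)"
    then have "nc_divides (quantum_plane q) r (qp_const 1)"
      by (auto simp: Units_def nc_divides_qp_iff intro: sym)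
    then have "worder \<alpha> \<beta> (qp_const 1 :: nat \<times> nat \<Rightarrow>\<^sub>0 'a) > 0"
      by (rule pos) (simp add: qp_const_def single_eq_0_iff)
    then show False
      by (simp add: qp_const_def worder_single weight_def)
  qed
  moreover have "nc_divides (quantum_plane q) r s \<or> nc_divides (quantum_plane q) r t"
    if "nc_divides (quantum_plane q) r (qp_mult q s t)" for s t
  proof (cases "s = 0 \<or> t = 0")
    case True
    then show ?thesis using dvd0 by auto
  next
    case False
    then have "worder \<alpha> \<beta> s + worder \<alpha> \<beta> t > 0"
      using pos[OF that] worder_mult[OF q] by (simp add: qp_mult_eq_0_iff[OF q])
    then have "worder \<alpha> \<beta> s > 0 \<or> worder \<alpha> \<beta> t > 0" by linarith
    then show ?thesis using dvd False by blast
  qed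
  ultimately show ?thesis
    using r(1) by (simp add: nc_prime_def)
qed

lemma nc_prime_qp_x:
  assumes "q \<noteq> 0"
  shows "nc_prime (quantum_plane q) qp_x"
proof (rule nc_prime_if_worder[OF assms, of 1 0])
  fix f :: "nat \<times> nat \<Rightarrow>\<^sub>0 'a" assume "worder 1 0 f > 0"
  then have "fst k > 0" if "k \<in> Poly_Mapping.keys f" for k
    using worder_le[OF that, of 1 0] by (simp add: weight_def)
  then obtain t where "f = qp_mult q qp_x t" by (rule qp_x_factor)
  then show "nc_divides (quantum_plane q) qp_x f" by (auto simp: nc_divides_qp_iff)
qed (simp_all add: qp_x_def single_eq_0_iff worder_single weight_def)

lemma nc_prime_qp_y:
  assumes "q \<noteq> 0"
  shows "nc_prime (quantum_plane q) qp_y"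
proof (rule nc_prime_if_worder[OF assms, of 0 1])
  fix f :: "nat \<times> nat \<Rightarrow>\<^sub>0 'a" assume "worder 0 1 f > 0"
  then have "snd k > 0" if "k \<in> Poly_Mapping.keys f" for k
    using worder_le[OF that, of 0 1] by (simp add: weight_def)
  then obtain t where "f = qp_mult q t qp_y" by (rule qp_y_factor)
  then show "nc_divides (quantum_plane q) qp_y f" by (auto simp: nc_divides_qp_iff)
qed (simp_all add: qp_y_def single_eq_0_iff worder_single weight_def)

section \<open>Degree and irreducibility\<close>

definition qp_degree :: "(nat \<times> nat \<Rightarrow>\<^sub>0 'a::zero) \<Rightarrow> int" where
  "qp_degree f = - worder (-1) (-1) f"

lemma qp_degree_mult:
  "q \<noteq> 0 \<Longrightarrow> f \<noteq> 0 \<Longrightarrow> g \<noteq> 0 \<Longrightarrow> qp_degree (qp_mult q f g) = qp_degree f + qp_degree g"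
  by (simp add: qp_degree_def worder_mult)

lemma qp_constantsI:
  assumes "Poly_Mapping.keys f \<subseteq> {(0, 0)}"
  shows "f \<in> qp_constants"
proof -
  have "f = qp_const (Poly_Mapping.lookup f (0, 0))"
  proof (rule poly_mapping_eqI)
    fix k
    show "Poly_Mapping.lookup f k =
        Poly_Mapping.lookup (qp_const (Poly_Mapping.lookup f (0, 0))) k"
      using assms by (cases k) (auto simp: qp_const_def lookup_single when_def in_keys_iff subset_iff)
  qed
  then show ?thesis by (auto simp: qp_constants_def)
qed

lemma zero_in_qp_constants [simp]: "0 \<in> qp_constants"
  by (rule qp_constantsI) simp

lemma qp_constants_if_degree_le_0:
  assumes "qp_degree f \<le> 0"
  shows "f \<in> qp_constants"
proof (rule qp_constantsI)
  show "Poly_Mapping.keys f \<subseteq> {(0, 0)}"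
  proof
    fix k assume "k \<in> Poly_Mapping.keys f"
    then have "worder (-1) (-1) f \<le> weight (-1) (-1) k" by (rule worder_le)
    then show "k \<in> {(0, 0)}"
      using assms by (cases k) (simp add: qp_degree_def weight_def)
  qed
qed

lemma qp_degree_pos: "f \<notin> qp_constants \<Longrightarrow> qp_degree f > 0"
  using qp_constants_if_degree_le_0[of f] by linarith

lemma qp_degree_nonneg:
  assumes "f \<noteq> 0"
  shows "qp_degree f \<ge> 0"
  by (rule worder_attained[OF assms, of "-1" "-1"]) (simp add: qp_degree_def weight_def)

lemma nc_divides_cofactor:
  assumes q: "q \<noteq> 0" and "s \<noteq> 0" "nc_divides (quantum_plane q) r s"
  obtains t where "s = qp_mult q r t \<or> s = qp_mult q t r" "t \<noteq> 0"
    "qp_degree s = qp_degree r + qp_degree t"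
proof -
  obtain t where t: "s = qp_mult q r t \<or> s = qp_mult q t r"
    using assms(3) unfolding nc_divides_qp_iff by blast
  then have nz: "r \<noteq> 0" "t \<noteq> 0" using \<open>s \<noteq> 0\<close> by auto
  then have "qp_degree s = qp_degree r + qp_degree t"
    using t qp_degree_mult[OF q] by fastforce
  with t nz(2) show thesis by (rule that)
qed

lemma qp_degree_le_if_nc_divides:
  assumes "q \<noteq> 0" "s \<noteq> 0" "nc_divides (quantum_plane q) r s"
  shows "qp_degree r \<le> qp_degree s"
  by (rule nc_divides_cofactor[OF assms]) (use qp_degree_nonneg in fastforce)

lemma nc_divides_scalar:
  assumes "q \<noteq> 0" "s \<noteq> 0" "nc_divides (quantum_plane q) r s" and le: "qp_degree s \<le> qp_degree r"
  obtains c where "s = qp_mult q (qp_const c) r"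
proof -
  obtain t where t: "s = qp_mult q r t \<or> s = qp_mult q t r"
    and "qp_degree s = qp_degree r + qp_degree t"
    using nc_divides_cofactor[OF assms(1-3)] by blast
  then have "t \<in> qp_constants"
    using le by (intro qp_constants_if_degree_le_0) simp
  then obtain c where "t = qp_const c" by (auto simp: qp_constants_def)
  then have "s = qp_mult q (qp_const c) r"
    using t by (auto simp: qp_const_mult)
  then show thesis by (rule that)
qed

lemma nc_prime_nonconstant:
  assumes "nc_prime (quantum_plane q) p"
  shows "p \<notin> qp_constants"
proof
  assume "p \<in> qp_constants"
  then obtain c where c: "p = qp_const c" by (auto simp: qp_constants_def)
  then have "c \<noteq> 0" using assms by (auto simp: nc_prime_def qp_const_def)
  then have "qp_mult q p (qp_const (inverse c)) = qp_const 1"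
      "qp_mult q (qp_const (inverse c)) p = qp_const 1"
    unfolding c qp_const_def by (simp_all add: qp_mult_single)
  then have "p \<in> Units (quantum_plane q)"
    by (auto simp: Units_def)
  then show False using assms by (simp add: nc_prime_def)
qed

lemma nc_prime_nonzero: "nc_prime (quantum_plane q) p \<Longrightarrow> p \<noteq> 0"
  by (simp add: nc_prime_def)

lemma nc_prime_dividesD:
  assumes "nc_prime (quantum_plane q) p" "nc_divides (quantum_plane q) p (qp_mult q s t)"
  shows "nc_divides (quantum_plane q) p s \<or> nc_divides (quantum_plane q) p t"
  using assms by (simp add: nc_prime_def)

text \<open>
  If a prime is a product, it divides one of the two factors, so that factor has at least its degree
  and the other one has degree 0.
\<close>

lemma nc_prime_irreducible:
  assumes q: "q \<noteq> 0" and p: "nc_prime (quantum_plane q) p"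
  shows "qp_irreducible q p"
proof -
  have False if gh: "g \<notin> qp_constants" "h \<notin> qp_constants" "p = qp_mult q g h" for g h
  proof -
    have nz: "g \<noteq> 0" "h \<noteq> 0" using gh by auto
    have "nc_divides (quantum_plane q) p (qp_mult q g h)"
      using gh(3) by (auto simp: nc_divides_qp_iff intro!: exI[of _ "qp_const 1"] simp: qp_one_mult)
    then have "qp_degree p \<le> qp_degree g \<or> qp_degree p \<le> qp_degree h"
      using nc_prime_dividesD[OF p] qp_degree_le_if_nc_divides[OF q] nz by blast
    then show False
      using qp_degree_mult[OF q nz] qp_degree_pos[OF gh(1)] qp_degree_pos[OF gh(2)]
      unfolding gh(3) by linarith
  qed
  then show ?thesis
    using nc_prime_nonconstant[OF p] by (auto simp: qp_irreducible_def qp_reducible_def)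
qed

lemma qp_degree_x: "qp_degree (qp_x :: nat \<times> nat \<Rightarrow>\<^sub>0 'a::field) = 1"
  and qp_degree_y: "qp_degree (qp_y :: nat \<times> nat \<Rightarrow>\<^sub>0 'a::field) = 1"
  by (simp_all add: qp_degree_def qp_x_def qp_y_def worder_single weight_def)

lemma scalar_multiple_if_divides_degree_1:
  assumes q: "q \<noteq> 0" and p: "p \<notin> qp_constants"
    and z: "z \<noteq> 0" "qp_degree z = 1" and dvd: "nc_divides (quantum_plane q) p z"
  shows "scalar_multiple_of q p z"
proof -
  obtain c where c: "z = qp_mult q (qp_const c) p"
    using nc_divides_scalar[OF q z(1) dvd] qp_degree_pos[OF p] z(2) by auto
  then have "c \<noteq> 0" using z(1) by (auto simp: qp_const_def)
  then have "qp_mult q (qp_const (inverse c)) z = p"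
    unfolding c by (simp add: qp_mult_assoc[symmetric] qp_const_def qp_mult_single
      qp_one_mult[unfolded qp_const_def])
  then show ?thesis by (auto simp: scalar_multiple_of_def)
qed

lemma irreducible_scalar_multiple_x:
  assumes p: "qp_irreducible q p" and keys: "\<And>k. k \<in> Poly_Mapping.keys p \<Longrightarrow> fst k > 0"
  shows "scalar_multiple_of q p qp_x"
proof -
  obtain t where t: "p = qp_mult q qp_x t" using keys by (rule qp_x_factor)
  have "p \<noteq> 0" using p by (auto simp: qp_irreducible_def)
  moreover have "(qp_x :: nat \<times> nat \<Rightarrow>\<^sub>0 'a) \<notin> qp_constants"
    using nc_prime_nonconstant[OF nc_prime_qp_x[of 1]] by simp
  ultimately have "t \<in> qp_constants"
    using p t by (auto simp: qp_irreducible_def qp_reducible_def)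
  then show ?thesis
    using t by (auto simp: qp_constants_def scalar_multiple_of_def qp_const_mult)
qed

lemma irreducible_scalar_multiple_y:
  assumes p: "qp_irreducible q p" and keys: "\<And>k. k \<in> Poly_Mapping.keys p \<Longrightarrow> snd k > 0"
  shows "scalar_multiple_of q p qp_y"
proof -
  obtain t where t: "p = qp_mult q t qp_y" using keys by (rule qp_y_factor)
  have "p \<noteq> 0" using p by (auto simp: qp_irreducible_def)
  moreover have "(qp_y :: nat \<times> nat \<Rightarrow>\<^sub>0 'a) \<notin> qp_constants"
    using nc_prime_nonconstant[OF nc_prime_qp_y[of 1]] by simp
  ultimately have "t \<in> qp_constants"
    using p t by (auto simp: qp_irreducible_def qp_reducible_def)
  then show ?thesis
    using t by (auto simp: qp_constants_def scalar_multiple_of_def)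
qed

section \<open>Commuting a prime past the generators\<close>

text \<open>The automorphism \<open>x \<mapsto> a x\<close>, \<open>y \<mapsto> b y\<close> when \<open>a\<close> and \<open>b\<close> are nonzero.\<close>

definition twist :: "'a::field \<Rightarrow> 'a \<Rightarrow> (nat \<times> nat \<Rightarrow>\<^sub>0 'a) \<Rightarrow> (nat \<times> nat \<Rightarrow>\<^sub>0 'a)" where
  "twist a b = Poly_Mapping.mapp (\<lambda>k c. a ^ fst k * b ^ snd k * c)"

lemma lookup_twist:
  "Poly_Mapping.lookup (twist a b f) k = a ^ fst k * b ^ snd k * Poly_Mapping.lookup f k"
  by (simp add: twist_def lookup_mapp when_def in_keys_iff)

lemma twist_zero [simp]: "twist a b 0 = 0"
  by (rule poly_mapping_eqI) (simp add: lookup_twist)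

lemma twist_add: "twist a b (f + g) = twist a b f + twist a b g"
  by (rule poly_mapping_eqI) (simp add: lookup_twist lookup_add algebra_simps)

lemma twist_single:
  "twist a b (Poly_Mapping.single k c) = Poly_Mapping.single k (a ^ fst k * b ^ snd k * c)"
  by (rule poly_mapping_eqI) (simp add: lookup_twist lookup_single when_def)

lemma keys_twist: "a \<noteq> 0 \<Longrightarrow> b \<noteq> 0 \<Longrightarrow> Poly_Mapping.keys (twist a b f) = Poly_Mapping.keys f"
  by (auto simp: in_keys_iff lookup_twist)

lemma lookup_qp_const_mult:
  "Poly_Mapping.lookup (qp_mult q (qp_const c) f) k = c * Poly_Mapping.lookup f k"
  by (induction f rule: poly_mapping_additive_induct)
    (auto simp: qp_const_def qp_mult_single qp_mult_add_right lookup_add lookup_single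
      when_def algebra_simps)

lemma qp_mult_x_right: "qp_mult q f qp_x = qp_mult q qp_x (twist 1 q f)"
proof (induction f rule: poly_mapping_additive_induct)
  case (2 k c)
  then show ?case by (cases k) (simp add: twist_single qp_x_def qp_mult_single)
qed (simp_all add: qp_mult_add_left qp_mult_add_right twist_add)

lemma qp_mult_y_left: "qp_mult q qp_y f = qp_mult q (twist q 1 f) qp_y"
proof (induction f rule: poly_mapping_additive_induct)
  case (2 k c)
  then show ?case by (cases k) (simp add: twist_single qp_y_def qp_mult_single)
qed (simp_all add: qp_mult_add_left qp_mult_add_right twist_add)

text \<open>
  A twist preserves the degree, so a polynomial that divides its twist is an eigenvector, and the
  twisting factors of all its monomials coincide.
\<close>

lemma nc_divides_twist_const:
  assumes q: "q \<noteq> 0" and ab: "a \<noteq> 0" "b \<noteq> 0" and "p \<noteq> 0"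
    and dvd: "nc_divides (quantum_plane q) p (twist a b p)"
  obtains c where "\<And>k. k \<in> Poly_Mapping.keys p \<Longrightarrow> a ^ fst k * b ^ snd k = c"
proof -
  have keys: "Poly_Mapping.keys (twist a b p) = Poly_Mapping.keys p"
    using ab by (rule keys_twist)
  then have "twist a b p \<noteq> 0" using \<open>p \<noteq> 0\<close> by (metis keys_eq_empty)
  moreover have "qp_degree (twist a b p) \<le> qp_degree p"
    using worder_cong[OF keys] by (simp add: qp_degree_def)
  ultimately obtain c where c: "twist a b p = qp_mult q (qp_const c) p"
    using nc_divides_scalar[OF q _ dvd] by blast
  then have "a ^ fst k * b ^ snd k * Poly_Mapping.lookup p k = c * Poly_Mapping.lookup p k" for k
    by (metis lookup_twist lookup_qp_const_mult)
  then show thesis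
    by (intro that[of c]) (auto simp: in_keys_iff)
qed

lemma nc_prime_trichotomy:
  assumes q: "q \<noteq> 0" and p: "nc_prime (quantum_plane q) p"
  shows "scalar_multiple_of q p qp_x \<or> scalar_multiple_of q p qp_y \<or>
    (\<forall>k\<in>Poly_Mapping.keys p. q ^ fst k = 1 \<and> q ^ snd k = 1)"
proof (cases "nc_divides (quantum_plane q) p qp_x \<or> nc_divides (quantum_plane q) p qp_y")
  case True
  then show ?thesis
    using scalar_multiple_if_divides_degree_1[OF q nc_prime_nonconstant[OF p] _ qp_degree_x]
      scalar_multiple_if_divides_degree_1[OF q nc_prime_nonconstant[OF p] _ qp_degree_y]
    by (auto simp: qp_x_def qp_y_def single_eq_0_iff)
next
  case False
  have irr: "qp_irreducible q p" using q p by (rule nc_prime_irreducible)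
  have "nc_divides (quantum_plane q) p (qp_mult q qp_x (twist 1 q p))"
    by (subst qp_mult_x_right[symmetric]) (auto simp: nc_divides_qp_iff)
  then have "nc_divides (quantum_plane q) p (twist 1 q p)"
    using nc_prime_dividesD[OF p] False by blast
  then obtain c where c: "\<And>k. k \<in> Poly_Mapping.keys p \<Longrightarrow> 1 ^ fst k * q ^ snd k = c"
    using nc_divides_twist_const[OF q _ q nc_prime_nonzero[OF p]] by (metis one_neq_zero)
  have "nc_divides (quantum_plane q) p (qp_mult q (twist q 1 p) qp_y)"
    by (subst qp_mult_y_left[symmetric]) (auto simp: nc_divides_qp_iff)
  then have "nc_divides (quantum_plane q) p (twist q 1 p)"
    using nc_prime_dividesD[OF p] False by blast
  then obtain d where d: "\<And>k. k \<in> Poly_Mapping.keys p \<Longrightarrow> q ^ fst k * 1 ^ snd k = d"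
    using nc_divides_twist_const[OF q q _ nc_prime_nonzero[OF p]] by (metis one_neq_zero)
  \<comment> \<open>A monomial with \<open>j = 0\<close> would force \<open>c = q^0 = 1\<close>, and one with \<open>i = 0\<close> would force \<open>d = 1\<close>.\<close>
  consider "c = 1" "d = 1" | "c \<noteq> 1" | "d \<noteq> 1" by blast
  then show ?thesis
  proof cases
    case 1
    then show ?thesis using c d by simp
  next
    case 2
    then have "snd k > 0" if "k \<in> Poly_Mapping.keys p" for k
      using c[OF that] by (cases "snd k") auto
    then show ?thesis using irreducible_scalar_multiple_y[OF irr] by blast
  next
    case 3
    then have "fst k > 0" if "k \<in> Poly_Mapping.keys p" for k
      using d[OF that] by (cases "fst k") auto
    then show ?thesis using irreducible_scalar_multiple_x[OF irr] by blast
  qed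
qed

text \<open>
  Under this condition all commutation factors between \<open>p\<close> and arbitrary monomials equal 1, so
  both products reduce to the commutative one.
\<close>

lemma central_in_if_powers_eq_1:
  assumes "\<And>k. k \<in> Poly_Mapping.keys p \<Longrightarrow> q ^ fst k = 1 \<and> q ^ snd k = 1"
  shows "central_in (quantum_plane q) p"
proof -
  have "qp_mult q p s = qp_mult q s p" for s
  proof -
    have "qp_mult q p s = (\<Sum>m\<in>Poly_Mapping.keys p. \<Sum>k\<in>Poly_Mapping.keys s.
        Poly_Mapping.single (fst k + fst m, snd k + snd m)
          (q ^ (snd k * fst m) * Poly_Mapping.lookup s k * Poly_Mapping.lookup p m))"
      unfolding qp_mult_def
    proof (intro sum.cong refl)
      fix m k assume "m \<in> Poly_Mapping.keys p"
      then have "q ^ (snd m * fst k) = 1" "q ^ (snd k * fst m) = 1"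
        using assms by (simp_all add: power_mult mult.commute[of "snd k"])
      then show "Poly_Mapping.single (fst m + fst k, snd m + snd k)
            (q ^ (snd m * fst k) * Poly_Mapping.lookup p m * Poly_Mapping.lookup s k) =
          Poly_Mapping.single (fst k + fst m, snd k + snd m)
            (q ^ (snd k * fst m) * Poly_Mapping.lookup s k * Poly_Mapping.lookup p m)"
        by (simp add: ac_simps)
    qed
    also have "\<dots> = qp_mult q s p"
      unfolding qp_mult_def by (rule sum.swap)
    finally show ?thesis .
  qed
  then show ?thesis by (simp add: central_in_def)
qed

theorem theorem12:
  fixes q :: "'a::field_char_0"
  assumes "q \<noteq> 0"
  shows "nc_prime (quantum_plane q) qp_x \<and>
    nc_prime (quantum_plane q) qp_y \<and>
    (\<not> root_of_unity q \<longrightarrow>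
      (\<forall>p. nc_prime (quantum_plane q) p \<longrightarrow>
        scalar_multiple_of q p qp_x \<or> scalar_multiple_of q p qp_y)) \<and>
    (\<forall>n. n > 0 \<and> primitive_root_of_unity n q \<longrightarrow>
      (\<forall>p. nc_prime (quantum_plane q) p \<longrightarrow>
        (central_in (quantum_plane q) p \<and> qp_irreducible q p) \<or>
        scalar_multiple_of q p qp_x \<or> scalar_multiple_of q p qp_y))"
proof (intro conjI impI allI)
  show "nc_prime (quantum_plane q) qp_x" using assms by (rule nc_prime_qp_x)
  show "nc_prime (quantum_plane q) qp_y" using assms by (rule nc_prime_qp_y)
next
  fix p assume "\<not> root_of_unity q" and p: "nc_prime (quantum_plane q) p"
  then have "m = 0" if "q ^ m = 1" for m
    using that by (auto simp: root_of_unity_def)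
  then have "Poly_Mapping.keys p \<subseteq> {(0, 0)}"
    if "\<forall>k\<in>Poly_Mapping.keys p. q ^ fst k = 1 \<and> q ^ snd k = 1"
    using that by force
  then show "scalar_multiple_of q p qp_x \<or> scalar_multiple_of q p qp_y"
    using nc_prime_trichotomy[OF assms p] nc_prime_nonconstant[OF p] qp_constantsI by blast
next
  fix n p assume p: "nc_prime (quantum_plane q) p"
  show "(central_in (quantum_plane q) p \<and> qp_irreducible q p) \<or>
      scalar_multiple_of q p qp_x \<or> scalar_multiple_of q p qp_y"
    using nc_prime_trichotomy[OF assms p] nc_prime_irreducible[OF assms p]
      central_in_if_powers_eq_1[of p q] by blast
qed

end
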